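(* Let $r$ and $n$ be integers such that $1 \le r \le n$ and $n \equiv 0 \pmod r$. If $F_1$ and $F_2$ are graphs on a common set of $n$ vertices, each of which consists of the vertex-disjoint union of $n/r$ copies of $K_r$, then $\gamma_{\rm sd}(F_1,F_2) = n/r$.
   Context: All graphs are finite and simple. Given graphs $F_1, F_2$ (called factors; not necessarily edge-disjoint) with common vertex set $V$, a set $S \subseteq V$ is a simultaneous dominating set if for each $i \in \{1,2\}$ every vertex not in $S$ is adjacent in $F_i$ to some vertex of $S$. The simultaneous domination number $\gamma_{\rm sd}(F_1,F_2)$ is the minimum cardinality of a simultaneous dominating set. *)

theory Defs
  imports "Graph_Theory.Kuratowski" "HOL-Library.Disjoint_Sets"
begin

(* Finite simple graphs are the finite loop-free symmetric digraphs without parallel arcs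
   (locale pair_graph): an edge uv is the pair of arcs (u,v), (v,u). *)

definition dominating_set :: "'a pair_pre_digraph \<Rightarrow> 'a set \<Rightarrow> bool" where
  "dominating_set F S \<longleftrightarrow>
     S \<subseteq> pverts F \<and> (\<forall>v \<in> pverts F - S. \<exists>u \<in> S. v \<rightarrow>\<^bsub>with_proj F\<^esub> u)"

(* Meant for factors with the same vertex set, so that both conjuncts quantify over it. *)
definition simultaneous_dominating_set ::
    "'a pair_pre_digraph \<Rightarrow> 'a pair_pre_digraph \<Rightarrow> 'a set \<Rightarrow> bool" where
  "simultaneous_dominating_set F1 F2 S \<longleftrightarrow> dominating_set F1 S \<and> dominating_set F2 S"

(* For finite factors on a common vertex set V, the set under Min is finite, and it is nonempty
   because V itself is a simultaneous dominating set. *)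
definition simultaneous_domination_number ::
    "'a pair_pre_digraph \<Rightarrow> 'a pair_pre_digraph \<Rightarrow> nat" (\<open>\<gamma>\<^sub>s\<^sub>d\<close>) where
  "\<gamma>\<^sub>s\<^sub>d F1 F2 = Min (card ` {S. simultaneous_dominating_set F1 F2 S})"

definition disjoint_union_of_complete :: "nat \<Rightarrow> nat \<Rightarrow> 'a pair_pre_digraph \<Rightarrow> bool" where
  "disjoint_union_of_complete m r G \<longleftrightarrow>
     (\<exists>H :: nat \<Rightarrow> 'a pair_pre_digraph.
        (\<forall>i<m. K\<^bsub>r\<^esub> (with_proj (H i))) \<and>
        disjoint_family_on (\<lambda>i. pverts (H i)) {..<m} \<and>
        pverts G = (\<Union>i<m. pverts (H i)) \<and>
        parcs G = (\<Union>i<m. parcs (H i)))"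

end

(* The vertex sets of the copies of K_r in F1 and in F2 are two partitions of V into m = n/r
   classes of size r.  A set dominates such a factor iff it meets every class, so it has at least m
   elements.  Conversely, the union of any k classes of the first partition has k r elements and
   hence meets at least k classes of the second; Hall's theorem then pairs up the classes of the two
   partitions so that paired classes intersect, and one common vertex from each pair suffices. *)

theory Submission
  imports Defs
begin

text \<open>Induction on \<open>I\<close>, split by whether some nonempty proper subfamily is tight,
  that is, has a union no larger than its index set. If so, that subfamily is matched inside its
  union and the rest outside it. If not, every nonempty proper subfamily has an element to spare, so
  one index may be matched arbitrarily.\<close>

theorem hall_marriage:
  assumes "finite I"
    and "\<And>i. i \<in> I \<Longrightarrow> finite (A i)"
    and "\<And>J. J \<subseteq> I \<Longrightarrow> card J \<le> card (\<Union>i\<in>J. A i)"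
  shows "\<exists>f. inj_on f I \<and> (\<forall>i\<in>I. f i \<in> A i)"
  using assms
proof (induction I arbitrary: A rule: finite_psubset_induct)
  case (psubset I)
  note fin = psubset.prems(1) and hall = psubset.prems(2)
  show ?case
  proof (cases "\<exists>J. J \<subset> I \<and> J \<noteq> {} \<and> card (\<Union>i\<in>J. A i) = card J")
    case True
    then obtain J where J: "J \<subset> I" "J \<noteq> {}" and tight: "card (\<Union>i\<in>J. A i) = card J"
      by blast
    let ?U = "\<Union>i\<in>J. A i"
    have finJ: "finite J" using J(1) \<open>finite I\<close> by (auto intro: finite_subset)
    have "\<exists>f. inj_on f J \<and> (\<forall>i\<in>J. f i \<in> A i)"
      using J(1) fin hall by (intro psubset.IH) auto
    then obtain f where f: "inj_on f J" "\<forall>i\<in>J. f i \<in> A i" by blast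
    have "\<exists>g. inj_on g (I - J) \<and> (\<forall>i\<in>I - J. g i \<in> A i - ?U)"
    proof (rule psubset.IH)
      fix L assume L: "L \<subseteq> I - J"
      then have finL: "finite L" using \<open>finite I\<close> finite_subset by blast
      \<comment> \<open>Hall's condition survives the removal of \<open>?U\<close>: apply it to
        \<open>L\<close> together with \<open>J\<close>; by tightness \<open>?U\<close> accounts for
        exactly \<open>card J\<close> elements of the union.\<close>
      have "card L + card J = card (L \<union> J)"
        using L finL finJ by (subst card_Un_disjoint) auto
      also have "\<dots> \<le> card (\<Union>i\<in>L \<union> J. A i)"
        using L J(1) by (intro hall) auto
      also have "(\<Union>i\<in>L \<union> J. A i) = (\<Union>i\<in>L. A i - ?U) \<union> ?U"
        by blast
      also have "card \<dots> \<le> card (\<Union>i\<in>L. A i - ?U) + card ?U"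
        by (rule card_Un_le)
      finally show "card L \<le> card (\<Union>i\<in>L. A i - ?U)"
        using tight by simp
    qed (use J fin in auto)
    then obtain g where g: "inj_on g (I - J)" "\<forall>i\<in>I - J. g i \<in> A i - ?U"
      by (elim exE conjE)
    let ?h = "\<lambda>i. if i \<in> J then f i else g i"
    \<comment> \<open>\<open>f\<close> maps \<open>J\<close> into \<open>?U\<close> while
      \<open>g\<close> avoids \<open>?U\<close>, so gluing the two matchings keeps
      injectivity.\<close>
    have cross: "f i \<noteq> g j" if "i \<in> J" "j \<in> I - J" for i j
      using f(2) bspec[OF g(2) that(2)] that(1) by auto
    have "inj_on ?h I"
    proof (rule inj_onI)
      fix i j assume "i \<in> I" "j \<in> I" "?h i = ?h j"
      then show "i = j"
        using cross[of i j] cross[of j i] inj_onD[OF f(1), of i j] inj_onD[OF g(1), of i j]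
        by (cases "i \<in> J"; cases "j \<in> J") simp_all
    qed
    moreover have "\<forall>i\<in>I. ?h i \<in> A i" using f(2) g(2) by auto
    ultimately show ?thesis by (intro exI[of _ ?h] conjI)
  next
    case False
    show ?thesis
    proof (cases "I = {}")
      case False
      then obtain k where k: "k \<in> I" by blast
      have "A k \<noteq> {}" using hall[of "{k}"] k by auto
      then obtain x where x: "x \<in> A k" by blast
      have "\<exists>g. inj_on g (I - {k}) \<and> (\<forall>i\<in>I - {k}. g i \<in> A i - {x})"
      proof (rule psubset.IH)
        fix L assume L: "L \<subseteq> I - {k}"
        show "card L \<le> card (\<Union>i\<in>L. A i - {x})"
        proof (cases "L = {}")
          case False
          \<comment> \<open>\<open>L\<close> misses \<open>k\<close>, so it is proper and hence not
            tight; its spare element pays for the deletion of \<open>x\<close>.\<close>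
          have "L \<subset> I" using L k by blast
          then have "card L \<noteq> card (\<Union>i\<in>L. A i)"
            using \<open>\<not> (\<exists>J. J \<subset> I \<and> J \<noteq> {} \<and> card (\<Union>i\<in>J. A i) = card J)\<close> False by metis
          with hall[of L] \<open>L \<subset> I\<close> have "card L \<le> card (\<Union>i\<in>L. A i) - 1" by force
          also have "\<dots> \<le> card ((\<Union>i\<in>L. A i) - {x})"
            by (simp add: card_Diff_singleton_if)
          also have "(\<Union>i\<in>L. A i) - {x} = (\<Union>i\<in>L. A i - {x})" by blast
          finally show ?thesis .
        qed simp
      qed (use k fin in auto)
      then obtain g where g: "inj_on g (I - {k})" "\<forall>i\<in>I - {k}. g i \<in> A i - {x}"
        by (elim exE conjE)
      have "inj_on (g(k := x)) I"
        using g by (auto simp: inj_on_def)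
      moreover have "\<forall>i\<in>I. (g(k := x)) i \<in> A i" using g(2) x by auto
      ultimately show ?thesis by (intro exI[of _ "g(k := x)"] conjI)
    qed simp
  qed
qed

lemma card_UN_disjoint_const:
  assumes "finite J" and "disjoint_family_on A J"
    and "\<And>i. i \<in> J \<Longrightarrow> finite (A i) \<and> card (A i) = r"
  shows "card (\<Union>i\<in>J. A i) = card J * r"
  using assms by (subst card_UN_disjoint) (auto simp: disjoint_family_on_def)

text \<open>Only an upper bound on \<open>card S\<close> is claimed: meeting the disjoint classes
  \<open>A i\<close> already forces the reverse inequality, by
  \<open>card_ge_of_meets_disjoint\<close>.\<close>

lemma common_transversal:
  assumes "finite I" and "0 < r"
    and A: "\<And>i. i \<in> I \<Longrightarrow> finite (A i) \<and> card (A i) = r" "disjoint_family_on A I"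
    and B: "\<And>i. i \<in> I \<Longrightarrow> finite (B i) \<and> card (B i) = r" "disjoint_family_on B I"
    and eq: "(\<Union>i\<in>I. A i) = (\<Union>i\<in>I. B i)"
  shows "\<exists>S \<subseteq> \<Union>i\<in>I. A i. card S \<le> card I \<and> (\<forall>i\<in>I. S \<inter> A i \<noteq> {} \<and> S \<inter> B i \<noteq> {})"
proof -
  \<comment> \<open>Hall's theorem is applied to indices rather than points: in the bipartite graph
    joining a class of \<open>A\<close> to the classes of \<open>B\<close> that it meets,
    \<open>?N i\<close> is the neighbourhood of \<open>i\<close>.\<close>
  let ?N = "\<lambda>i. {j \<in> I. A i \<inter> B j \<noteq> {}}"
  have "\<exists>f. inj_on f I \<and> (\<forall>i\<in>I. f i \<in> ?N i)"
  proof (rule hall_marriage)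
    fix J assume J: "J \<subseteq> I"
    let ?M = "\<Union>i\<in>J. ?N i"
    have finJ: "finite J" and M: "?M \<subseteq> I" "finite ?M"
      using J \<open>finite I\<close> by (auto intro: finite_subset)
    have "card J * r = card (\<Union>i\<in>J. A i)"
      using J finJ A by (intro card_UN_disjoint_const[symmetric])
        (auto intro: disjoint_family_on_mono)
    also have "\<dots> \<le> card (\<Union>j\<in>?M. B j)"
    proof (rule card_mono)
      show "finite (\<Union>j\<in>?M. B j)" using M B(1) by blast
      show "(\<Union>i\<in>J. A i) \<subseteq> (\<Union>j\<in>?M. B j)"
      proof
        fix x assume "x \<in> (\<Union>i\<in>J. A i)"
        then obtain i where i: "i \<in> J" "x \<in> A i" by blast
        with J have "x \<in> (\<Union>i\<in>I. A i)" by auto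
        then obtain j where j: "j \<in> I" "x \<in> B j" unfolding eq by blast
        with i have "j \<in> ?M" by auto
        with j(2) show "x \<in> (\<Union>j\<in>?M. B j)" by (rule UN_I[rotated])
      qed
    qed
    also have "\<dots> = card ?M * r"
      using M B by (intro card_UN_disjoint_const) (auto intro: disjoint_family_on_mono)
    finally show "card J \<le> card ?M" using \<open>0 < r\<close> by simp
  qed (use \<open>finite I\<close> in auto)
  then obtain f where f: "inj_on f I" "\<forall>i\<in>I. f i \<in> I \<and> A i \<inter> B (f i) \<noteq> {}"
    by auto
  \<comment> \<open>An injective self-map of a finite set is a permutation, so no class of
    \<open>B\<close> is left unpaired.\<close>
  then have onto: "f ` I = I"
    using \<open>finite I\<close> by (intro endo_inj_surj) auto
  have "\<forall>i\<in>I. \<exists>x. x \<in> A i \<inter> B (f i)" using f(2) by blast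
  then obtain v where v: "\<forall>i\<in>I. v i \<in> A i \<inter> B (f i)" by metis
  have "v ` I \<inter> B j \<noteq> {}" if "j \<in> I" for j
  proof -
    have "j \<in> f ` I" using that onto by simp
    then obtain i where "j = f i" "i \<in> I" by (rule imageE)
    then have "v i \<in> v ` I \<inter> B j" using v by simp
    then show ?thesis by auto
  qed
  moreover have "card (v ` I) \<le> card I" using \<open>finite I\<close> by (rule card_image_le)
  moreover have "v ` I \<subseteq> (\<Union>i\<in>I. A i)" "\<forall>i\<in>I. v ` I \<inter> A i \<noteq> {}" using v by auto
  ultimately show ?thesis by (intro exI[of _ "v ` I"] conjI ballI) auto
qed

text \<open>Choosing a point of \<open>S\<close> in each class is injective, because the classes are
  disjoint.\<close>

lemma card_ge_of_meets_disjoint: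
  assumes "finite S" and "disjoint_family_on A I" and "\<And>i. i \<in> I \<Longrightarrow> S \<inter> A i \<noteq> {}"
  shows "card I \<le> card S"
proof -
  have "\<forall>i\<in>I. \<exists>x. x \<in> S \<inter> A i" using assms(3) by blast
  then obtain v where v: "\<forall>i\<in>I. v i \<in> S \<inter> A i" by metis
  then have "inj_on v I"
    using assms(2) by (fastforce simp: inj_on_def disjoint_family_on_def)
  then show ?thesis
    using v \<open>finite S\<close> by (intro card_inj_on_le) auto
qed

text \<open>Reduces the graph problem to one about partitions: the neighbours of a vertex are
  exactly the other vertices of its class. Positivity of \<open>r\<close> makes each class nonempty,
  so that a dominating set has a vertex to serve there.\<close>

lemma disjoint_union_of_completeE:
  assumes "disjoint_union_of_complete m r G" and "0 < r"
  obtains A where "\<And>i. i < m \<Longrightarrow> finite (A i) \<and> card (A i) = r"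
    and "disjoint_family_on A {..<m}" and "pverts G = (\<Union>i<m. A i)"
    and "\<And>S. dominating_set G S \<longleftrightarrow> S \<subseteq> pverts G \<and> (\<forall>i<m. S \<inter> A i \<noteq> {})"
proof -
  obtain H :: "nat \<Rightarrow> 'a pair_pre_digraph" where
    complete: "\<And>i. i < m \<Longrightarrow> K\<^bsub>r\<^esub> (with_proj (H i))"
    and disj: "disjoint_family_on (\<lambda>i. pverts (H i)) {..<m}"
    and verts: "pverts G = (\<Union>i<m. pverts (H i))"
    and arcs: "parcs G = (\<Union>i<m. parcs (H i))"
    using assms(1) unfolding disjoint_union_of_complete_def by blast
  have H: "finite (pverts (H i)) \<and> card (pverts (H i)) = r" if "i < m" for i
    using complete[OF that] by (simp add: complete_digraph_pair_def)
  have H_arcs: "(u, v) \<in> parcs (H i) \<longleftrightarrow> u \<in> pverts (H i) \<and> v \<in> pverts (H i) \<and> u \<noteq> v"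
    if "i < m" for i u v
    using complete[OF that] by (simp add: complete_digraph_pair_def)
  have dom: "dominating_set G S \<longleftrightarrow> S \<subseteq> pverts G \<and> (\<forall>i<m. S \<inter> pverts (H i) \<noteq> {})" for S
  proof (intro iffI conjI allI impI)
    assume S: "dominating_set G S"
    then show "S \<subseteq> pverts G" by (simp add: dominating_set_def)
    fix i assume i: "i < m"
    then have "pverts (H i) \<noteq> {}" using H[OF i] \<open>0 < r\<close> by auto
    then obtain w where w: "w \<in> pverts (H i)" by blast
    show "S \<inter> pverts (H i) \<noteq> {}"
    proof (cases "w \<in> S")
      case False
      have "w \<in> pverts G" using verts w i by blast
      with False S obtain u where u: "u \<in> S" "(w, u) \<in> parcs G"
        by (auto simp: dominating_set_def)
      \<comment> \<open>The arc from \<open>w\<close> to \<open>u\<close> comes from some copy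
        \<open>j\<close>; since \<open>w\<close> lies in copies \<open>i\<close> and
        \<open>j\<close>, disjointness identifies them and puts \<open>u\<close> in class
        \<open>i\<close>.\<close>
      then obtain j where j: "j < m" "w \<in> pverts (H j)" "u \<in> pverts (H j)"
        using arcs H_arcs by auto
      then have "i = j" using disj w i by (auto simp: disjoint_family_on_def)
      with j u show ?thesis by blast
    qed (use w in blast)
  next
    assume S: "S \<subseteq> pverts G \<and> (\<forall>i<m. S \<inter> pverts (H i) \<noteq> {})"
    have "\<exists>u\<in>S. (w, u) \<in> parcs G" if w: "w \<in> pverts G - S" for w
    proof -
      obtain i where i: "i < m" "w \<in> pverts (H i)" using w verts by blast
      then obtain u where u: "u \<in> S" "u \<in> pverts (H i)" using S by blast
      \<comment> \<open>The vertices differ because \<open>u\<close> is in \<open>S\<close> and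
        \<open>w\<close> is not, so completeness supplies the arc.\<close>
      have "(w, u) \<in> parcs (H i)" using i u w by (auto simp: H_arcs)
      then show ?thesis using i(1) u(1) arcs by blast
    qed
    then show "dominating_set G S" using S by (auto simp: dominating_set_def)
  qed
  show thesis using that[OF H disj verts dom] .
qed

theorem theorem15:
  fixes r n :: nat and V :: "'a set" and F1 F2 :: "'a pair_pre_digraph"
  assumes "1 \<le> r" and "r \<le> n" and "n mod r = 0"
    and "pair_graph F1" and "pair_graph F2"
    and "pverts F1 = V" and "pverts F2 = V" and "card V = n"
    and "disjoint_union_of_complete (n div r) r F1"
    and "disjoint_union_of_complete (n div r) r F2"
  shows "\<gamma>\<^sub>s\<^sub>d F1 F2 = n div r"
proof -
  let ?m = "n div r"
  have r: "0 < r" using \<open>1 \<le> r\<close> by simp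
  obtain A where A: "\<And>i. i < ?m \<Longrightarrow> finite (A i) \<and> card (A i) = r"
      "disjoint_family_on A {..<?m}" "pverts F1 = (\<Union>i<?m. A i)"
    and dom1: "\<And>S. dominating_set F1 S \<longleftrightarrow> S \<subseteq> pverts F1 \<and> (\<forall>i<?m. S \<inter> A i \<noteq> {})"
    by (rule disjoint_union_of_completeE[OF assms(9) r]) (rule that)
  obtain B where B: "\<And>i. i < ?m \<Longrightarrow> finite (B i) \<and> card (B i) = r"
      "disjoint_family_on B {..<?m}" "pverts F2 = (\<Union>i<?m. B i)"
    and dom2: "\<And>S. dominating_set F2 S \<longleftrightarrow> S \<subseteq> pverts F2 \<and> (\<forall>i<?m. S \<inter> B i \<noteq> {})"
    by (rule disjoint_union_of_completeE[OF assms(10) r]) (rule that)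
  have "finite V" using A(1,3) \<open>pverts F1 = V\<close> by auto
  let ?D = "{S. simultaneous_dominating_set F1 F2 S}"
  \<comment> \<open>\<open>Min\<close> needs a finite nonempty set: this inclusion gives finiteness,
    and the transversal \<open>S\<close> obtained below gives nonemptiness.\<close>
  have sub: "?D \<subseteq> Pow V"
    using dom1 \<open>pverts F1 = V\<close> by (auto simp: simultaneous_dominating_set_def)
  then have "finite ?D" using \<open>finite V\<close> by (auto intro: finite_subset)
  have lower: "?m \<le> card S" if "S \<in> ?D" for S
  proof -
    have "finite S" using that sub \<open>finite V\<close> by (auto intro: finite_subset)
    then have "card {..<?m} \<le> card S"
      using that dom1 A(2)
      by (intro card_ge_of_meets_disjoint) (auto simp: simultaneous_dominating_set_def)
    then show ?thesis by simp
  qed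
  \<comment> \<open>Both families partition the same set \<open>V\<close>, so a single set of at
    most \<open>?m\<close> vertices meets every class of both and therefore dominates both
    factors.\<close>
  have "\<exists>S \<subseteq> \<Union>i<?m. A i. card S \<le> card {..<?m} \<and>
      (\<forall>i\<in>{..<?m}. S \<inter> A i \<noteq> {} \<and> S \<inter> B i \<noteq> {})"
    using A B r \<open>pverts F1 = V\<close> \<open>pverts F2 = V\<close> by (intro common_transversal) auto
  then obtain S where "S \<subseteq> V" "card S \<le> ?m" "\<forall>i<?m. S \<inter> A i \<noteq> {} \<and> S \<inter> B i \<noteq> {}"
    using A(3) \<open>pverts F1 = V\<close> by auto
  then have S: "S \<in> ?D" "card S \<le> ?m"
    using dom1 dom2 \<open>pverts F1 = V\<close> \<open>pverts F2 = V\<close>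
    by (auto simp: simultaneous_dominating_set_def)
  have "card S = ?m" using S lower[OF S(1)] by simp
  then have "Min (card ` ?D) = ?m"
    using S(1) \<open>finite ?D\<close> lower by (intro Min_eqI) (auto intro: rev_image_eqI)
  then show ?thesis by (simp add: simultaneous_domination_number_def)
qed

end
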